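(* Let $n\ge1$ and let $\lambda=\sum_{i=1}^n m_i\omega_i$, $\mu=\sum_{i=1}^n m_i'\omega_i$ with $m_i,m_i'\in\mathbb Z_{\ge0}$. Then the Minkowski sum of sets satisfies $$FFLV^{\mathbb Z}_{2n+1}(\lambda)+FFLV^{\mathbb Z}_{2n+1}(\mu)=FFLV^{\mathbb Z}_{2n+1}(\lambda+\mu).$$
   Context: Here $\omega_1,\dots,\omega_n$ are the fundamental weights of $\mathfrak{sp}_{2n}$ (for the statement only the coefficient tuple $(m_1,\dots,m_n)$ of a weight matters, and $\lambda+\mu=\sum(m_i+m'_i)\omega_i$). Consider the poset whose elements are symbols $\alpha_{i,j}$ ($1\le i\le j\le n$) and $\alpha_{i,\overline j}$ ($1\le i\le j\le n$), all distinct, arranged in rows $i=1,\dots,n$, with arrows $\alpha_{i,i}\to\alpha_{i,i+1}\to\dots\to\alpha_{i,n}\to\alpha_{i,\overline n}\to\alpha_{i,\overline{n-1}}\to\dots\to\alpha_{i,\overline i}$ along each row and vertical arrows $\alpha_{i,j}\to\alpha_{i+1,j}$, $\alpha_{i,\overline j}\to\alpha_{i+1,\overline j}$ for $i+1\le j\le n$. A symplectic Dyck path is a sequence $p=(p(0),\dots,p(k))$ ($k\ge0$), each $p(t)\to p(t+1)$ being an arrow, with $p(0)=\alpha_{i,i}$ for some $i$ and $p(k)=\alpha_{j,j}$ or $p(k)=\alpha_{j,\overline j}$ for some $j\ge i$. For $\lambda=\sum m_i\omega_i$, $FFLV_{2n+1}(\lambda)\subset\mathbb R_{\ge0}^{n(n+1)}$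 is the set of $\mathbf s=(s_\alpha)$, indexed by the elements of the poset, such that for each symplectic Dyck path $p$: $\sum_{\alpha\in p}s_\alpha\le m_i+\dots+m_j$ if $p(0)=\alpha_{i,i}$, $p(k)=\alpha_{j,j}$; and $\sum_{\alpha\in p}s_\alpha\le m_i+\dots+m_n$ if $p(0)=\alpha_{i,i}$, $p(k)=\alpha_{j,\overline j}$. $FFLV^{\mathbb Z}_{2n+1}(\lambda)$ is the set of points of $FFLV_{2n+1}(\lambda)$ with integer coordinates. The Minkowski sum of sets $A,B$ is $\{a+b: a\in A,b\in B\}$. *)

theory Defs
  imports Complex_Main "HOL-Library.Function_Algebras" "HOL-Library.Set_Algebras"
begin

text \<open>\<open>Plain i j\<close> stands for $\alpha_{i,j}$ and \<open>Barred i j\<close> for $\alpha_{i,\overline j}$.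
  In particular $\alpha_{i,n}$ and $\alpha_{i,\overline n}$ are different symbols.\<close>

datatype root = Plain nat nat | Barred nat nat

definition roots :: "nat \<Rightarrow> root set" where
  "roots n = {Plain i j | i j. 1 \<le> i \<and> i \<le> j \<and> j \<le> n}
           \<union> {Barred i j | i j. 1 \<le> i \<and> i \<le> j \<and> j \<le> n}"

inductive arrow :: "nat \<Rightarrow> root \<Rightarrow> root \<Rightarrow> bool" for n :: nat where
  row_plain: "1 \<le> i \<Longrightarrow> i \<le> j \<Longrightarrow> j + 1 \<le> n \<Longrightarrow> arrow n (Plain i j) (Plain i (j + 1))"
| row_turn: "1 \<le> i \<Longrightarrow> i \<le> n \<Longrightarrow> arrow n (Plain i n) (Barred i n)"
| row_barred: "1 \<le> i \<Longrightarrow> i \<le> j \<Longrightarrow> j + 1 \<le> n \<Longrightarrow> arrow n (Barred i (j + 1)) (Barred i j)"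
| col_plain: "1 \<le> i \<Longrightarrow> i + 1 \<le> j \<Longrightarrow> j \<le> n \<Longrightarrow> arrow n (Plain i j) (Plain (i + 1) j)"
| col_barred: "1 \<le> i \<Longrightarrow> i + 1 \<le> j \<Longrightarrow> j \<le> n \<Longrightarrow> arrow n (Barred i j) (Barred (i + 1) j)"

definition symplectic_dyck_path :: "nat \<Rightarrow> root list \<Rightarrow> bool" where
  "symplectic_dyck_path n p \<longleftrightarrow>
     p \<noteq> [] \<and> set p \<subseteq> roots n \<and> successively (arrow n) p \<and>
     (\<exists>i. hd p = Plain i i \<and> (\<exists>j\<ge>i. last p = Plain j j \<or> last p = Barred j j))"

text \<open>A weight $\sum_{i=1}^n m_i\omega_i$ is given by its coefficients \<open>m\<close>, of which only
  \<open>m 1, \<dots>, m n\<close> matter. A point of $\mathbb R^{n(n+1)}$ is a function on symbols that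
  vanishes outside \<open>roots n\<close>, so that points are determined by their coordinates
  and pointwise addition is the addition of $\mathbb R^{n(n+1)}$. The symbols on a Dyck path are
  pairwise distinct, so the sum along \<open>p\<close> may be taken over \<open>set p\<close>.\<close>

definition FFLV :: "nat \<Rightarrow> (nat \<Rightarrow> nat) \<Rightarrow> (root \<Rightarrow> real) set" where
  "FFLV n m = {s.
     (\<forall>\<alpha>. \<alpha> \<notin> roots n \<longrightarrow> s \<alpha> = 0) \<and>
     (\<forall>\<alpha>\<in>roots n. 0 \<le> s \<alpha>) \<and>
     (\<forall>p i j. symplectic_dyck_path n p \<longrightarrow>
        (hd p = Plain i i \<and> last p = Plain j j \<longrightarrow>
           (\<Sum>\<alpha>\<in>set p. s \<alpha>) \<le> real (\<Sum>k=i..j. m k)) \<and>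
        (hd p = Plain i i \<and> last p = Barred j j \<longrightarrow>
           (\<Sum>\<alpha>\<in>set p. s \<alpha>) \<le> real (\<Sum>k=i..n. m k)))}"

definition FFLV_int :: "nat \<Rightarrow> (nat \<Rightarrow> nat) \<Rightarrow> (root \<Rightarrow> real) set" where
  "FFLV_int n m = {s \<in> FFLV n m. \<forall>\<alpha>\<in>roots n. s \<alpha> \<in> \<int>}"

end

theory Submission
  imports Defs
begin

text \<open>
  The polytope is a marked chain polytope: with $\lambda_i = m_i + \dots + m_n$, a path from
  $\alpha_{i,i}$ has weight at most $\lambda_i$ minus the mark of its end, the marks of
  $\alpha_{j,j}$ and $\alpha_{j,\overline j}$ being $\lambda_{j+1}$ and $0$. The (inverse) transfer
  map sends a point $s$ to the function $x$ with $x_\alpha = s_\alpha + y_\alpha$, where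
  $y_\alpha$ is the maximum of the mark of $\alpha$ and of the $x_\beta$ with $\alpha \to \beta$.
  For $s$ in the polytope of $\lambda + \mu$, choose monotone integral functions $f, g$ with
  $f(t) + g(t) = t$, $f(\lambda_i + \mu_i) = \lambda_i$ and $g(\lambda_i + \mu_i) = \mu_i$.
  Monotone functions commute with maxima, so $s = (f(x) - f(y)) + (g(x) - g(y))$ is the required
  decomposition.
\<close>

section \<open>Marks, and the rank function of the poset\<close>

text \<open>These are the values \<lambda>_k. For \<open>k > n\<close> the sum is empty, which gives
  \<open>Plain n n\<close> the mark 0.\<close>

definition tail :: "nat \<Rightarrow> (nat \<Rightarrow> nat) \<Rightarrow> nat \<Rightarrow> real" where
  "tail n m k = real (\<Sum>i=k..n. m i)"

fun row :: "root \<Rightarrow> nat" where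
  "row (Plain i j) = i"
| "row (Barred i j) = i"

text \<open>The rank in the poset: each arrow raises it by exactly 1, and on \<open>roots n\<close>
  it is at most \<open>2 * n + 1\<close>. This bounds the recursion and keeps a symbol from
  recurring on a path.\<close>

fun height :: "nat \<Rightarrow> root \<Rightarrow> nat" where
  "height n (Plain i j) = i + j"
| "height n (Barred i j) = i + (2 * n + 1 - j)"

lemma arrow_in_roots:
  assumes "arrow n \<alpha> \<beta>"
  shows "\<alpha> \<in> roots n" "\<beta> \<in> roots n"
  using assms by (auto elim!: arrow.cases simp: roots_def)

lemma arrow_row_le: "arrow n \<alpha> \<beta> \<Longrightarrow> row \<alpha> \<le> row \<beta>"
  by (auto elim!: arrow.cases)

lemma arrow_height_less: "arrow n \<alpha> \<beta> \<Longrightarrow> height n \<alpha> < height n \<beta>"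
  by (auto elim!: arrow.cases)

lemma arrow_height_measure:
  "arrow n \<alpha> \<beta> \<Longrightarrow> 2 * n + 1 - height n \<beta> < 2 * n + 1 - height n \<alpha>"
  by (auto elim!: arrow.cases)

lemma finite_roots: "finite (roots n)"
proof (rule finite_subset)
  show "roots n \<subseteq> case_prod Plain ` ({..n} \<times> {..n}) \<union> case_prod Barred ` ({..n} \<times> {..n})"
    by (force simp: roots_def)
qed auto

lemma finite_arrow: "finite {\<beta>. arrow n \<alpha> \<beta>}"
  by (rule finite_subset[OF _ finite_roots[of n]]) (auto dest: arrow_in_roots)

lemma roots_arrow_cases:
  assumes "\<alpha> \<in> roots n"
  obtains j where "\<alpha> = Plain j j" | j where "\<alpha> = Barred j j" | \<beta> where "arrow n \<alpha> \<beta>"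
proof (cases \<alpha>)
  case (Plain i j)
  with assms that show thesis
    using col_plain[of i j n] by (cases "i = j") (auto simp: roots_def)
next
  case (Barred i j)
  with assms that show thesis
    using col_barred[of i j n] by (cases "i = j") (auto simp: roots_def)
qed

section \<open>The transfer map\<close>

text \<open>Off the diagonal \<open>\<alpha>\<close> is not the end of a Dyck path; the junk mark \<open>0\<close> is harmless because
  such an \<open>\<alpha>\<close> has a successor, whose transfer value is nonnegative.\<close>

fun mark :: "(nat \<Rightarrow> real) \<Rightarrow> root \<Rightarrow> real" where
  "mark L (Plain i j) = (if i = j then L (j + 1) else 0)"
| "mark L (Barred i j) = 0"

text \<open>Unfolded, this is the largest weight of a chain of arrows from \<alpha>, counting the
  mark of its last symbol. Inserting the mark also keeps the maximum over a nonempty set where no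
  arrow leaves.\<close>

function transfer :: "nat \<Rightarrow> (nat \<Rightarrow> real) \<Rightarrow> (root \<Rightarrow> real) \<Rightarrow> root \<Rightarrow> real" where
  "transfer n L s \<alpha> = s \<alpha> + Max (insert (mark L \<alpha>) (transfer n L s ` {\<beta>. arrow n \<alpha> \<beta>}))"
  by auto
termination
  by (relation "measure (\<lambda>(n, L, s, \<alpha>). 2 * n + 1 - height n \<alpha>)")
    (simp_all only: mem_Collect_eq in_measure case_prod_conv arrow_height_measure wf_measure)

declare transfer.simps [simp del]

text \<open>This is y_\<alpha>, named separately because the monotone functions are applied to x and
  to y.\<close>

definition succ_max :: "nat \<Rightarrow> (nat \<Rightarrow> real) \<Rightarrow> (root \<Rightarrow> real) \<Rightarrow> root \<Rightarrow> real" where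
  "succ_max n L s \<alpha> = Max (insert (mark L \<alpha>) (transfer n L s ` {\<beta>. arrow n \<alpha> \<beta>}))"

lemma transfer_eq: "transfer n L s \<alpha> = s \<alpha> + succ_max n L s \<alpha>"
  unfolding succ_max_def by (rule transfer.simps)

lemma mark_le_succ_max: "mark L \<alpha> \<le> succ_max n L s \<alpha>"
  unfolding succ_max_def by (intro Max_ge) (auto simp: finite_arrow)

lemma transfer_le_succ_max: "arrow n \<alpha> \<beta> \<Longrightarrow> transfer n L s \<beta> \<le> succ_max n L s \<alpha>"
  unfolding succ_max_def by (intro Max_ge) (auto simp: finite_arrow)

lemma succ_max_cases:
  obtains "succ_max n L s \<alpha> = mark L \<alpha>"
  | \<beta> where "arrow n \<alpha> \<beta>" "succ_max n L s \<alpha> = transfer n L s \<beta>"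
proof -
  have "succ_max n L s \<alpha> \<in> insert (mark L \<alpha>) (transfer n L s ` {\<beta>. arrow n \<alpha> \<beta>})"
    unfolding succ_max_def by (intro Max_in) (auto simp: finite_arrow)
  with that show thesis by auto
qed

text \<open>The rank is bounded along arrows, so properties propagate backwards from the symbols
  without successors.\<close>

lemma arrow_induct [case_names step]:
  assumes "\<And>\<alpha>. (\<And>\<beta>. arrow n \<alpha> \<beta> \<Longrightarrow> P \<beta>) \<Longrightarrow> P \<alpha>"
  shows "P \<alpha>"
proof (induction "2 * n + 1 - height n \<alpha>" arbitrary: \<alpha> rule: less_induct)
  case less
  show ?case
    by (rule assms) (rule less.hyps[OF arrow_height_measure])
qed

lemma mark_nonneg: "(\<And>k. 0 \<le> L k) \<Longrightarrow> 0 \<le> mark L \<alpha>"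
  by (cases \<alpha>) auto

lemma mark_Ints: "(\<And>k. L k \<in> \<int>) \<Longrightarrow> mark L \<alpha> \<in> \<int>"
  by (cases \<alpha>) auto

lemma succ_max_nonneg: "(\<And>k. 0 \<le> L k) \<Longrightarrow> 0 \<le> succ_max n L s \<alpha>"
  using mark_nonneg mark_le_succ_max order_trans by meson

lemma succ_max_Ints:
  assumes "\<And>k. L k \<in> \<int>" "\<And>\<alpha>. s \<alpha> \<in> \<int>"
  shows "succ_max n L s \<alpha> \<in> \<int>"
proof (induction \<alpha> rule: arrow_induct[of n])
  case (step \<alpha>)
  show ?case
    by (rule succ_max_cases[of n L s \<alpha>])
      (use step assms in \<open>auto simp: mark_Ints transfer_eq\<close>)
qed

section \<open>Transfer values as path weights\<close>

text \<open>Following successors at which the maximum is attained yields the path. The bound on rows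
  later places the end in a row \<open>j \<ge> i\<close>; the bound on heights serves the
  induction.\<close>

lemma transfer_le_path:
  assumes L: "\<And>k. 0 \<le> L k" and s: "\<And>\<alpha>. 0 \<le> s \<alpha>" and "\<alpha> \<in> roots n"
  shows "\<exists>p. p \<noteq> [] \<and> hd p = \<alpha> \<and> set p \<subseteq> roots n \<and> successively (arrow n) p \<and>
    (\<exists>j. last p = Plain j j \<or> last p = Barred j j) \<and>
    (\<forall>\<beta>\<in>set p. row \<alpha> \<le> row \<beta> \<and> height n \<alpha> \<le> height n \<beta>) \<and>
    transfer n L s \<alpha> \<le> (\<Sum>\<beta>\<in>set p. s \<beta>) + mark L (last p)"
    (is "\<exists>p. ?P \<alpha> p")
  using \<open>\<alpha> \<in> roots n\<close>
proof (induction \<alpha> rule: arrow_induct[of n])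
  case (step \<alpha>)
  \<comment> \<open>An inequality suffices here, so this covers both a successor attaining the
    maximum and, off the diagonal, an arbitrary successor when the maximum is the mark 0.\<close>
  have extend: "\<exists>p. ?P \<alpha> p" if \<beta>: "arrow n \<alpha> \<beta>" "succ_max n L s \<alpha> \<le> transfer n L s \<beta>" for \<beta>
  proof -
    from step.IH[OF \<beta>(1)] arrow_in_roots[OF \<beta>(1)] obtain p where p: "?P \<beta> p" by blast
    \<comment> \<open>All of \<open>p\<close> has larger rank than \<alpha>, so the sum over the set
      really gains \<open>s \<alpha>\<close>.\<close>
    have "\<alpha> \<notin> set p" using p arrow_height_less[OF \<beta>(1)] by fastforce
    then have sum: "(\<Sum>\<gamma>\<in>set (\<alpha> # p). s \<gamma>) = s \<alpha> + (\<Sum>\<gamma>\<in>set p. s \<gamma>)" by simp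
    have "row \<alpha> \<le> row \<gamma> \<and> height n \<alpha> \<le> height n \<gamma>" if "\<gamma> \<in> set p" for \<gamma>
      using p that arrow_height_less[OF \<beta>(1)] arrow_row_le[OF \<beta>(1)] by fastforce
    moreover have "transfer n L s \<alpha> \<le> (\<Sum>\<gamma>\<in>set (\<alpha> # p). s \<gamma>) + mark L (last (\<alpha> # p))"
      unfolding sum using p \<beta>(2) by (simp add: transfer_eq[of n L s \<alpha>])
    ultimately have "?P \<alpha> (\<alpha> # p)"
      using p \<beta>(1) step.prems by (simp add: successively_Cons)
    then show ?thesis by blast
  qed
  show ?case
  proof (cases "\<exists>j. \<alpha> = Plain j j \<or> \<alpha> = Barred j j")
    case True
    show ?thesis
    proof (rule succ_max_cases[of n L s \<alpha>])
      assume "succ_max n L s \<alpha> = mark L \<alpha>"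
      then have "?P \<alpha> [\<alpha>]" using step.prems True by (simp add: transfer_eq)
      then show ?thesis by blast
    qed (simp add: extend)
  next
    case False
    show ?thesis
    proof (rule succ_max_cases[of n L s \<alpha>])
      assume "succ_max n L s \<alpha> = mark L \<alpha>"
      moreover have "mark L \<alpha> = 0" using False by (cases \<alpha>) auto
      moreover obtain \<beta> where "arrow n \<alpha> \<beta>"
        using roots_arrow_cases[OF step.prems] False by blast
      moreover have "0 \<le> transfer n L s \<beta>"
        using s succ_max_nonneg[of L n s \<beta>, OF L] by (simp add: transfer_eq)
      ultimately show ?thesis by (intro extend) auto
    qed (simp add: extend)
  qed
qed

lemma tail_nonneg: "0 \<le> tail n m k"
  unfolding tail_def by (rule of_nat_0_le_iff)

lemma tail_Ints: "tail n m k \<in> \<int>"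
  unfolding tail_def by (rule Ints_of_nat)

lemma tail_split:
  assumes "i \<le> j" "j \<le> n"
  shows "tail n m i = real (\<Sum>k=i..j. m k) + tail n m (j + 1)"
proof -
  have "{i..n} = {i..j} \<union> {j+1..n}" using assms by auto
  then show ?thesis
    unfolding tail_def by (simp add: sum.union_disjoint del: of_nat_sum)
qed

text \<open>The defining inequalities of the polytope enter here: the bound for a Dyck path from
  \<open>Plain i i\<close> plus the mark of its end is exactly \<lambda>_i, for both kinds of
  end.\<close>

lemma transfer_diagonal_le:
  assumes "s \<in> FFLV n m" and i: "1 \<le> i" "i \<le> n"
  shows "transfer n (tail n m) s (Plain i i) \<le> tail n m i"
proof -
  have nonneg: "0 \<le> s \<alpha>" for \<alpha>
    using assms(1) by (cases "\<alpha> \<in> roots n") (auto simp: FFLV_def)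
  have "Plain i i \<in> roots n" using i by (auto simp: roots_def)
  from transfer_le_path[of "tail n m" s, OF tail_nonneg nonneg this]
  have "\<exists>p. p \<noteq> [] \<and> hd p = Plain i i \<and> set p \<subseteq> roots n \<and> successively (arrow n) p \<and>
    (\<exists>j. last p = Plain j j \<or> last p = Barred j j) \<and> (\<forall>\<beta>\<in>set p. i \<le> row \<beta>) \<and>
    transfer n (tail n m) s (Plain i i) \<le> (\<Sum>\<beta>\<in>set p. s \<beta>) + mark (tail n m) (last p)"
    (is "\<exists>p. ?P p")
    by (elim ex_forward) auto
  then obtain p where "?P p" ..
  then obtain j where p: "p \<noteq> []" "hd p = Plain i i" "set p \<subseteq> roots n" "successively (arrow n) p"
    "last p = Plain j j \<or> last p = Barred j j" "\<forall>\<beta>\<in>set p. i \<le> row \<beta>"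
    "transfer n (tail n m) s (Plain i i) \<le> (\<Sum>\<beta>\<in>set p. s \<beta>) + mark (tail n m) (last p)"
    by (elim conjE exE)
  have "last p \<in> roots n" "i \<le> row (last p)" using p(1,3,6) last_in_set by auto
  then have j: "i \<le> j" "j \<le> n" using p(5) by (auto simp: roots_def)
  then have "symplectic_dyck_path n p" using p unfolding symplectic_dyck_path_def by blast
  then have *: "last p = Plain j j \<longrightarrow> (\<Sum>\<beta>\<in>set p. s \<beta>) \<le> real (\<Sum>k=i..j. m k)"
    "last p = Barred j j \<longrightarrow> (\<Sum>\<beta>\<in>set p. s \<beta>) \<le> real (\<Sum>k=i..n. m k)"
    using assms(1) p(2) unfolding FFLV_def by blast+
  show ?thesis
    using p(5)
  proof
    assume "last p = Plain j j"
    then show ?thesis using p(7) * tail_split[OF j, of m] by simp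
  next
    assume "last p = Barred j j"
    then show ?thesis using p(7) * by (simp add: tail_def)
  qed
qed

section \<open>Each summand satisfies the path inequalities\<close>

text \<open>The sum of \<open>x - y\<close> telescopes, since x at the next symbol is at most y at
  the current one.\<close>

lemma sum_path_le:
  fixes d x y :: "root \<Rightarrow> real"
  assumes "\<And>\<alpha>. 0 \<le> d \<alpha>" "\<And>\<alpha>. d \<alpha> = x \<alpha> - y \<alpha>" "\<And>\<alpha> \<beta>. arrow n \<alpha> \<beta> \<Longrightarrow> x \<beta> \<le> y \<alpha>"
    and "p \<noteq> []" "successively (arrow n) p"
  shows "(\<Sum>\<alpha>\<in>set p. d \<alpha>) \<le> x (hd p) - y (last p)"
  using assms(4,5)
proof (induction p rule: list_nonempty_induct)
  case (single \<alpha>)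
  then show ?case using assms(2) by simp
next
  case (cons \<alpha> p)
  then have "(\<Sum>\<beta>\<in>set p. d \<beta>) \<le> x (hd p) - y (last p)" "x (hd p) \<le> y \<alpha>"
    using assms(3) by (auto simp: successively_Cons)
  \<comment> \<open>If \<alpha> occurs again in \<open>p\<close>, the sum over the set gains no
    term, and \<open>0 \<le> d \<alpha>\<close> gives the bound.\<close>
  then show ?case
    using assms(1)[of \<alpha>] assms(2)[of \<alpha>] cons(1) by (auto simp: sum.insert_if)
qed

text \<open>A monotone \<open>f\<close> preserves the inequalities between x, y and the marks.
  Telescoping therefore bounds a path sum by \<open>f\<close> of the starting mark minus
  \<open>f\<close> of the end mark, and \<open>f\<close> turns the marks for \<open>M\<close> into
  those for \<open>m\<close>. It is applied to both halves of the splitting.\<close>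

lemma split_summand_in_FFLV_int:
  assumes s: "s \<in> FFLV_int n M" and f: "mono f" "\<And>t. t \<in> \<int> \<Longrightarrow> f t \<in> \<int>"
    and fL: "\<And>k. 1 \<le> k \<Longrightarrow> f (tail n M k) = tail n m k"
  shows "(\<lambda>\<alpha>. f (transfer n (tail n M) s \<alpha>) - f (succ_max n (tail n M) s \<alpha>)) \<in> FFLV_int n m"
proof -
  let ?x = "transfer n (tail n M) s" and ?y = "succ_max n (tail n M) s"
  define d where "d \<alpha> = f (?x \<alpha>) - f (?y \<alpha>)" for \<alpha>
  have sF: "s \<in> FFLV n M" using s by (simp add: FFLV_int_def)
  have s0: "s \<alpha> = 0" if "\<alpha> \<notin> roots n" for \<alpha> using sF that by (simp add: FFLV_def)
  have nonneg: "0 \<le> s \<alpha>" for \<alpha>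
    using sF s0 by (cases "\<alpha> \<in> roots n") (auto simp: FFLV_def)
  have sint: "s \<alpha> \<in> \<int>" for \<alpha>
    using s s0 by (cases "\<alpha> \<in> roots n") (auto simp: FFLV_int_def)
  have yint: "?y \<alpha> \<in> \<int>" for \<alpha>
    by (rule succ_max_Ints) (auto simp: tail_Ints sint)
  have d0: "0 \<le> d \<alpha>" for \<alpha>
    using monoD[OF f(1), of "?y \<alpha>" "?x \<alpha>"] nonneg[of \<alpha>] by (simp add: d_def transfer_eq)
  have dint: "d \<alpha> \<in> \<int>" for \<alpha>
    unfolding d_def using yint sint by (simp add: transfer_eq f(2))
  \<comment> \<open>At \<open>k = n + 1\<close> both tails are empty. This handles barred ends,
    whose mark is 0.\<close>
  have fzero: "f 0 = 0" using fL[of "n + 1"] by (simp add: tail_def)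
  have path: "(\<Sum>\<alpha>\<in>set p. d \<alpha>) \<le> tail n m i - f (mark (tail n M) (last p))"
    if p: "symplectic_dyck_path n p" "hd p = Plain i i" for p i
  proof -
    have "Plain i i \<in> roots n" using p hd_in_set[of p] by (auto simp: symplectic_dyck_path_def)
    then have i: "1 \<le> i" "i \<le> n" by (auto simp: roots_def)
    have "(\<Sum>\<alpha>\<in>set p. d \<alpha>) \<le> f (?x (hd p)) - f (?y (last p))"
      by (rule sum_path_le[where n = n])
        (use p d0 in \<open>auto simp: symplectic_dyck_path_def d_def
          intro!: monoD[OF f(1)] transfer_le_succ_max\<close>)
    moreover have "f (?x (hd p)) \<le> tail n m i"
      using monoD[OF f(1) transfer_diagonal_le[OF sF i]] fL i p by simp
    moreover have "f (mark (tail n M) (last p)) \<le> f (?y (last p))"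
      by (intro monoD[OF f(1)] mark_le_succ_max)
    ultimately show ?thesis by linarith
  qed
  have "(\<Sum>\<alpha>\<in>set p. d \<alpha>) \<le> real (\<Sum>k=i..j. m k)"
    if p: "symplectic_dyck_path n p" "hd p = Plain i i" "last p = Plain j j" for p i j
  proof -
    have "i \<le> j" "Plain j j \<in> roots n"
      using p last_in_set[of p] by (auto simp: symplectic_dyck_path_def)
    then have "tail n m i = real (\<Sum>k=i..j. m k) + tail n m (j + 1)"
      by (intro tail_split) (auto simp: roots_def)
    then show ?thesis using path[OF p(1,2)] p(3) fL[of "j + 1"] by simp
  qed
  moreover have "(\<Sum>\<alpha>\<in>set p. d \<alpha>) \<le> real (\<Sum>k=i..n. m k)"
    if p: "symplectic_dyck_path n p" "hd p = Plain i i" "last p = Barred j j" for p i j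
    using path[OF p(1,2)] p(3) fzero by (simp add: tail_def)
  moreover have "d \<alpha> = 0" if "\<alpha> \<notin> roots n" for \<alpha>
    using s0[OF that] by (simp add: d_def transfer_eq)
  ultimately have "d \<in> FFLV_int n m"
    using d0 dint unfolding FFLV_int_def FFLV_def by blast
  then show ?thesis unfolding d_def .
qed

section \<open>Splitting the identity into monotone integral functions\<close>

text \<open>For \<open>0 \<le> c\<close>, the function \<open>clamp (t - a) c\<close> of
  \<open>t\<close> is a ramp: 0 up to \<open>a\<close>, of slope 1 until \<open>a + c\<close>, then
  constantly \<open>c\<close>.\<close>

definition clamp :: "real \<Rightarrow> real \<Rightarrow> real" where
  "clamp t c = max 0 (min t c)"

lemma clamp_mono: "t \<le> u \<Longrightarrow> clamp t c \<le> clamp u c"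
  by (auto simp: clamp_def)

lemma clamp_Ints: "t \<in> \<int> \<Longrightarrow> c \<in> \<int> \<Longrightarrow> clamp t c \<in> \<int>"
  by (auto simp: clamp_def max_def min_def)

lemma tail_antimono: "i \<le> j \<Longrightarrow> tail n m j \<le> tail n m i"
  unfolding tail_def of_nat_le_iff by (rule sum_mono2) auto

lemma tail_step: "i \<le> n \<Longrightarrow> tail n m i = real (m i) + tail n m (i + 1)"
  using tail_split[of i i n m] by simp

text \<open>Each ramp is a difference of truncations of \<open>t\<close> at consecutive marks, so
  the sum telescopes; the last truncation, at 0, vanishes because \<open>0 \<le> t\<close>.\<close>

lemma sum_clamp_tail:
  "0 \<le> t \<Longrightarrow> (\<Sum>i=1..n. clamp (t - tail n m (i + 1)) (real (m i))) = min t (tail n m 1)"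
proof -
  assume t: "0 \<le> t"
  have "(\<Sum>i=1..n. clamp (t - tail n m (i + 1)) (real (m i)))
      = (\<Sum>i=1..n. min t (tail n m i) - min t (tail n m (i + 1)))"
    by (rule sum.cong) (auto simp: clamp_def tail_step)
  also have "\<dots> = (\<Sum>i=1..<Suc n. min t (tail n m i) - min t (tail n m (Suc i)))"
    by (simp add: atLeastLessThanSuc_atLeastAtMost)
  also have "\<dots> = min t (tail n m 1) - min t (tail n m (Suc n))"
    using sum_Suc_diff'[of 1 "Suc n" "\<lambda>i. - min t (tail n m i)"] by simp
  finally show ?thesis using t by (simp add: tail_def)
qed

text \<open>On the interval between the marks at \<open>i + 1\<close> and \<open>i\<close>, of length \<open>m i + m' i\<close>, the function
  \<open>f\<close> grows with slope 1 on the first part, of length \<open>m i\<close>, and \<open>g\<close> on the rest. The last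
  summand of \<open>g\<close> gives \<open>f t + g t = t\<close> beyond the largest mark.\<close>

lemma split_identity:
  fixes m m' :: "nat \<Rightarrow> nat"
  defines "M \<equiv> (\<lambda>i. m i + m' i)"
  obtains f g :: "real \<Rightarrow> real" where
    "mono f" "\<And>t. t \<in> \<int> \<Longrightarrow> f t \<in> \<int>" "\<And>k. 1 \<le> k \<Longrightarrow> f (tail n M k) = tail n m k"
    "mono g" "\<And>t. t \<in> \<int> \<Longrightarrow> g t \<in> \<int>" "\<And>k. 1 \<le> k \<Longrightarrow> g (tail n M k) = tail n m' k"
    "\<And>t. 0 \<le> t \<Longrightarrow> f t + g t = t"
proof
  define f where "f t = (\<Sum>i=1..n. clamp (t - tail n M (i + 1)) (real (m i)))" for t
  define g where "g t = (\<Sum>i=1..n. clamp (t - tail n M (i + 1) - real (m i)) (real (m' i)))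
    + max 0 (t - tail n M 1)" for t
  show "mono f" unfolding f_def
    by (intro monoI sum_mono clamp_mono) simp
  show "mono g" unfolding g_def
    by (intro monoI add_mono sum_mono clamp_mono) auto
  show "f t \<in> \<int>" if "t \<in> \<int>" for t
    unfolding f_def using that by (intro Ints_sum clamp_Ints Ints_diff tail_Ints) auto
  show "g t \<in> \<int>" if "t \<in> \<int>" for t
    unfolding g_def using that tail_Ints[of n M 1]
    by (intro Ints_sum clamp_Ints Ints_diff tail_Ints Ints_add) (auto simp: max_def)
  show add: "f t + g t = t" if "0 \<le> t" for t
  proof -
    \<comment> \<open>A ramp of length \<open>m i\<close> followed at once by one of length
      \<open>m' i\<close> is a single ramp of length \<open>M i\<close>.\<close>
    have "clamp u (real (m i)) + clamp (u - real (m i)) (real (m' i)) = clamp u (real (M i))" for u i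
      by (auto simp: clamp_def M_def)
    then have "f t + g t = min t (tail n M 1) + max 0 (t - tail n M 1)"
      using sum_clamp_tail[OF that, of n M]
      by (simp add: f_def g_def flip: sum.distrib)
    then show ?thesis by simp
  qed
  show fL: "f (tail n M k) = tail n m k" if "1 \<le> k" for k
  proof -
    \<comment> \<open>At the k-th mark the ramps with \<open>i \<ge> k\<close> are complete and
      those with \<open>i < k\<close> have not begun. The index starts at 1 because
      \<open>tail n m 0\<close> would also contain \<open>m 0\<close>.\<close>
    have "f (tail n M k) = (\<Sum>i=1..n. if k \<le> i then real (m i) else 0)"
      unfolding f_def
    proof (rule sum.cong)
      fix i assume i: "i \<in> {1..n}"
      then have "tail n M i = real (m i) + real (m' i) + tail n M (i + 1)"
        by (simp add: tail_step M_def)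
      moreover have "tail n M i \<le> tail n M k" if "k \<le> i" using that by (rule tail_antimono)
      moreover have "tail n M k \<le> tail n M (i + 1)" if "\<not> k \<le> i"
        using that by (intro tail_antimono) simp
      ultimately show "clamp (tail n M k - tail n M (i + 1)) (real (m i)) =
          (if k \<le> i then real (m i) else 0)"
        by (auto simp: clamp_def)
    qed simp
    also have "\<dots> = (\<Sum>i\<in>{1..n} \<inter> {i. k \<le> i}. real (m i))"
      by (simp add: sum.inter_restrict)
    also have "{1..n} \<inter> {i. k \<le> i} = {k..n}" using that by auto
    finally show ?thesis by (simp add: tail_def)
  qed
  show "g (tail n M k) = tail n m' k" if "1 \<le> k" for k
  proof -
    \<comment> \<open>The value of \<open>g\<close> follows from that of \<open>f\<close>, as the
      two add up to the identity.\<close>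
    have "tail n M k = tail n m k + tail n m' k"
      by (simp add: tail_def M_def sum.distrib)
    then show ?thesis using add[OF tail_nonneg, of n M k] fL[OF that] by linarith
  qed
qed

section \<open>The two inclusions of the Minkowski sum identity\<close>

lemma FFLV_add:
  assumes "s \<in> FFLV n m" "s' \<in> FFLV n m'"
  shows "s + s' \<in> FFLV n (\<lambda>i. m i + m' i)"
proof -
  have "(\<Sum>\<alpha>\<in>set p. (s + s') \<alpha>) \<le> real (\<Sum>k=i..j. m k + m' k)"
    if "symplectic_dyck_path n p" "hd p = Plain i i" "last p = Plain j j" for p i j
  proof -
    have "(\<Sum>\<alpha>\<in>set p. s \<alpha>) \<le> real (\<Sum>k=i..j. m k)"
      "(\<Sum>\<alpha>\<in>set p. s' \<alpha>) \<le> real (\<Sum>k=i..j. m' k)"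
      using assms that unfolding FFLV_def by blast+
    then show ?thesis by (simp add: sum.distrib)
  qed
  moreover have "(\<Sum>\<alpha>\<in>set p. (s + s') \<alpha>) \<le> real (\<Sum>k=i..n. m k + m' k)"
    if "symplectic_dyck_path n p" "hd p = Plain i i" "last p = Barred j j" for p i j
  proof -
    have "(\<Sum>\<alpha>\<in>set p. s \<alpha>) \<le> real (\<Sum>k=i..n. m k)"
      "(\<Sum>\<alpha>\<in>set p. s' \<alpha>) \<le> real (\<Sum>k=i..n. m' k)"
      using assms that unfolding FFLV_def by blast+
    then show ?thesis by (simp add: sum.distrib)
  qed
  moreover have "(s + s') \<alpha> = 0" if "\<alpha> \<notin> roots n" for \<alpha>
    using assms that by (simp add: FFLV_def)
  moreover have "0 \<le> (s + s') \<alpha>" if "\<alpha> \<in> roots n" for \<alpha>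
    using assms that by (simp add: FFLV_def)
  ultimately show ?thesis unfolding FFLV_def by blast
qed

theorem theorem1p14:
  fixes n :: nat and m m' :: "nat \<Rightarrow> nat"
  assumes "n \<ge> 1"
  shows "FFLV_int n m + FFLV_int n m' = FFLV_int n (\<lambda>i. m i + m' i)"
proof
  show "FFLV_int n m + FFLV_int n m' \<subseteq> FFLV_int n (\<lambda>i. m i + m' i)"
    by (auto simp: set_plus_def FFLV_int_def FFLV_add)
next
  show "FFLV_int n (\<lambda>i. m i + m' i) \<subseteq> FFLV_int n m + FFLV_int n m'"
  proof
    fix s assume s: "s \<in> FFLV_int n (\<lambda>i. m i + m' i)"
    let ?L = "tail n (\<lambda>i. m i + m' i)"
    let ?x = "transfer n ?L s" and ?y = "succ_max n ?L s"
    obtain f g :: "real \<Rightarrow> real" where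
      f: "mono f" "\<And>t. t \<in> \<int> \<Longrightarrow> f t \<in> \<int>" "\<And>k. 1 \<le> k \<Longrightarrow> f (?L k) = tail n m k"
      and g: "mono g" "\<And>t. t \<in> \<int> \<Longrightarrow> g t \<in> \<int>" "\<And>k. 1 \<le> k \<Longrightarrow> g (?L k) = tail n m' k"
      and fg: "\<And>t. 0 \<le> t \<Longrightarrow> f t + g t = t"
      by (fact split_identity)
    \<comment> \<open>The sum of \<open>f\<close> and \<open>g\<close> is the identity only on
      nonnegative reals, so x and y must be nonnegative.\<close>
    have y: "0 \<le> ?y \<alpha>" for \<alpha> by (rule succ_max_nonneg) (rule tail_nonneg)
    have "0 \<le> s \<alpha>" for \<alpha>
      using s by (cases "\<alpha> \<in> roots n") (auto simp: FFLV_int_def FFLV_def)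
    then have x: "0 \<le> ?x \<alpha>" for \<alpha> using y by (simp add: transfer_eq)
    \<comment> \<open>Write \<open>s \<alpha>\<close> as x - y and split both terms by
      \<open>f\<close> and \<open>g\<close>.\<close>
    have "s \<alpha> = (f (?x \<alpha>) - f (?y \<alpha>)) + (g (?x \<alpha>) - g (?y \<alpha>))" for \<alpha>
      using fg[OF x, of \<alpha>] fg[OF y, of \<alpha>] transfer_eq[of n ?L s \<alpha>] by linarith
    then have "s = (\<lambda>\<alpha>. f (?x \<alpha>) - f (?y \<alpha>)) + (\<lambda>\<alpha>. g (?x \<alpha>) - g (?y \<alpha>))"
      by (simp add: fun_eq_iff)
    then show "s \<in> FFLV_int n m + FFLV_int n m'"
      using set_plus_intro[OF split_summand_in_FFLV_int[OF s f] split_summand_in_FFLV_int[OF s g]]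
      by simp
  qed
qed

end
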